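(* Let $a,b>0$ and $0\leq \nu,\tau\leq 1$. If $(b-a)(\tau-\nu)\geq 0$, then $$\tau(1-\tau)(a\nabla_{\nu}b-a!_{\nu}b)\leq\nu(1-\nu)(a\nabla_{\tau}b-a!_{\tau}b).$$ If $(b-a)(\tau-\nu)\leq 0$, then $$\tau(1-\tau)(a\nabla_{\nu}b-a!_{\nu}b)\geq\nu(1-\nu)(a\nabla_{\tau}b-a!_{\tau}b).$$
   Context: For $a,b>0$ and $0\le t\le 1$: $a!_t b=((1-t)a^{-1}+tb^{-1})^{-1}$ is the weighted harmonic mean and $a\nabla_t b=(1-t)a+tb$ is the weighted arithmetic mean. *)

theory Defs
  imports Complex_Main
begin

definition weighted_arith_mean :: "real \<Rightarrow> real \<Rightarrow> real \<Rightarrow> real" where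
  "weighted_arith_mean t a b = (1 - t) * a + t * b"

definition weighted_harm_mean :: "real \<Rightarrow> real \<Rightarrow> real \<Rightarrow> real" where
  "weighted_harm_mean t a b = inverse ((1 - t) * inverse a + t * inverse b)"

end

theory Submission
  imports Defs
begin

text \<open>The gap between the two means has the closed form
  \<open>t (1 - t) (b - a)^2 / D_t\<close>, where \<open>D_t = (1 - t) b + t a\<close>,
  so multiplying the gap at \<open>\<nu>\<close> by \<open>\<tau> (1 - \<tau>)\<close> and the gap at \<open>\<tau>\<close> by \<open>\<nu> (1 - \<nu>)\<close> gives the
  same nonnegative numerator on both sides. Only the positive denominators are left to compare,
  and they are affine in the weight: \<open>D_\<nu> - D_\<tau> = (b - a) (\<tau> - \<nu>)\<close>. The two halves of the
  statement are one inequality with \<open>\<nu>\<close> and \<open>\<tau>\<close> exchanged.\<close>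

lemma dual_weight_pos:
  fixes a b t :: real
  assumes "a > 0" "b > 0" "0 \<le> t" "t \<le> 1"
  shows "(1 - t) * b + t * a > 0"
proof (cases "t = 0")
  case False
  then have "t * a > 0" using assms by simp
  moreover have "(1 - t) * b \<ge> 0" using assms by simp
  ultimately show ?thesis by linarith
qed (use assms in simp)

text \<open>The harmonic mean equals \<open>a b / D_t\<close>, and the identity then amounts to
  \<open>((1 - t) a + t b) D_t - a b = t (1 - t) (b - a)^2\<close>.\<close>

lemma arith_minus_harm_mean:
  fixes a b t :: real
  assumes "a > 0" "b > 0" "0 \<le> t" "t \<le> 1"
  shows "weighted_arith_mean t a b - weighted_harm_mean t a b
       = t * (1 - t) * (b - a)\<^sup>2 / ((1 - t) * b + t * a)"
proof -
  define D where "D = (1 - t) * b + t * a"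
  have D: "D > 0" unfolding D_def by (rule dual_weight_pos[OF assms])
  have "(1 - t) * inverse a + t * inverse b = D / (a * b)"
    unfolding D_def using assms by (simp add: field_simps)
  then have harm: "weighted_harm_mean t a b = a * b / D"
    by (simp add: weighted_harm_mean_def)
  have "weighted_arith_mean t a b * D - a * b = t * (1 - t) * (b - a)\<^sup>2"
    unfolding weighted_arith_mean_def D_def by (simp add: algebra_simps power2_eq_square)
  then have "weighted_arith_mean t a b - a * b / D = t * (1 - t) * (b - a)\<^sup>2 / D"
    using D by (simp add: field_simps)
  then show ?thesis unfolding harm D_def .
qed

lemma scaled_mean_gap_mono:
  fixes a b \<nu> \<tau> :: real
  assumes pos: "a > 0" "b > 0"
    and \<nu>: "0 \<le> \<nu>" "\<nu> \<le> 1"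
    and \<tau>: "0 \<le> \<tau>" "\<tau> \<le> 1"
    and order: "(b - a) * (\<tau> - \<nu>) \<ge> 0"
  shows "\<tau> * (1 - \<tau>) * (weighted_arith_mean \<nu> a b - weighted_harm_mean \<nu> a b)
       \<le> \<nu> * (1 - \<nu>) * (weighted_arith_mean \<tau> a b - weighted_harm_mean \<tau> a b)"
proof -
  define N where "N = \<nu> * (1 - \<nu>) * (\<tau> * (1 - \<tau>)) * (b - a)\<^sup>2"
  have "N \<ge> 0" unfolding N_def using \<nu> \<tau> by simp
  moreover have "(1 - \<tau>) * b + \<tau> * a \<le> (1 - \<nu>) * b + \<nu> * a"
    using order by (simp add: algebra_simps)
  ultimately have "N / ((1 - \<nu>) * b + \<nu> * a) \<le> N / ((1 - \<tau>) * b + \<tau> * a)"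
    using dual_weight_pos[OF pos \<tau>] by (intro frac_le) auto
  then show ?thesis
    unfolding arith_minus_harm_mean[OF pos \<nu>] arith_minus_harm_mean[OF pos \<tau>] N_def
    by (simp add: mult_ac)
qed

theorem proposition2p8:
  fixes a b \<nu> \<tau> :: real
  assumes "a > 0" and "b > 0"
    and "0 \<le> \<nu>" and "\<nu> \<le> 1"
    and "0 \<le> \<tau>" and "\<tau> \<le> 1"
  shows "((b - a) * (\<tau> - \<nu>) \<ge> 0 \<longrightarrow>
            \<tau> * (1 - \<tau>) * (weighted_arith_mean \<nu> a b - weighted_harm_mean \<nu> a b)
              \<le> \<nu> * (1 - \<nu>) * (weighted_arith_mean \<tau> a b - weighted_harm_mean \<tau> a b))
       \<and> ((b - a) * (\<tau> - \<nu>) \<le> 0 \<longrightarrow>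
            \<tau> * (1 - \<tau>) * (weighted_arith_mean \<nu> a b - weighted_harm_mean \<nu> a b)
              \<ge> \<nu> * (1 - \<nu>) * (weighted_arith_mean \<tau> a b - weighted_harm_mean \<tau> a b))"
proof (intro conjI impI)
  assume "(b - a) * (\<tau> - \<nu>) \<ge> 0"
  with assms show "\<tau> * (1 - \<tau>) * (weighted_arith_mean \<nu> a b - weighted_harm_mean \<nu> a b)
      \<le> \<nu> * (1 - \<nu>) * (weighted_arith_mean \<tau> a b - weighted_harm_mean \<tau> a b)"
    by (intro scaled_mean_gap_mono)
next
  assume "(b - a) * (\<tau> - \<nu>) \<le> 0"
  then have "(b - a) * (\<nu> - \<tau>) \<ge> 0" by (simp add: algebra_simps)
  with assms show "\<tau> * (1 - \<tau>) * (weighted_arith_mean \<nu> a b - weighted_harm_mean \<nu> a b)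
      \<ge> \<nu> * (1 - \<nu>) * (weighted_arith_mean \<tau> a b - weighted_harm_mean \<tau> a b)"
    by (intro scaled_mean_gap_mono)
qed

end
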